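(* Let $d\ge 1$ be an integer and let $\phi:[0,1]\to[0,\infty)$ be a measurable function that is not almost everywhere zero. Put $\theta(p)=\int_0^1 t^{-d/p}\phi(t)\,dt$ and $U_\phi[f](x)=\int_0^1 f(tx)\,\phi(t)\,dt$ for $x\in\mathbb{R}^d$. Call $\psi$ admissible if $\psi\in\Psi(a;b)$ for some $1\le a<b\le\infty$ and $\operatorname{supp}\psi\cap\operatorname{supp}\theta$ is an interval with non-empty interior $(A,B)$. For admissible $\psi$ set $\psi_\theta(p)=\psi(p)\,\theta(p)$ for $p\in(A,B)$. Then for every admissible $\psi$ and every $f\in G(\psi)$, $$\|U_\phi[f]\|_{G(\psi_\theta)}\le 1\cdot\|f\|_{G(\psi)},$$ and the constant $1$ is best possible, in the following sense: if $\theta(p)<\infty$ for some $p\in[1,\infty)$, then $$\sup_{\psi}\ \sup_{f\in G(\psi),\,f\ne 0}\ \frac{\|U_\phi[f]\|_{G(\psi_\theta)}}{\|f\|_{G(\psi)}}=1,$$ where the outer supremum is over all admissible $\psi$.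
   Context: For measurable $f:\mathbb{R}^d\to\mathbb{R}$ and $1\le p<\infty$, $|f|_p=\left(\int_{\mathbb{R}^d}|f(x)|^p\,dx\right)^{1/p}$ (Lebesgue measure). For $1\le a<b\le\infty$, $\Psi(a;b)$ denotes the set of continuous positive functions $\psi$ on the open interval $(a,b)$ with $\inf_{p\in(a,b)}\psi(p)>0$; one writes $\operatorname{supp}\psi=(a,b)$. The (bilateral) Grand Lebesgue Space $G(\psi)$ consists of all measurable functions $f:\mathbb{R}^d\to\mathbb{R}$ (modulo equality almost everywhere) with finite norm $$\|f\|_{G(\psi)}=\sup_{p\in(a,b)}\frac{|f|_p}{\psi(p)}.$$ The norm $\|\cdot\|_{G(\psi_\theta)}$ is defined in the same way, with $\psi_\theta$ in place of $\psi$ and with the supremum over $p\in(A,B)$. $\operatorname{supp}\theta=\{p\in[1,\infty):\theta(p)<\infty\}$. *)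

theory Defs
  imports "HOL-Analysis.Analysis"
begin

text \<open>
  "Measurable" means Lebesgue measurable, and norms take values in \<^typ>\<open>ennreal\<close>.
  Elements of the function spaces are represented by functions rather than by
  classes modulo equality almost everywhere; accordingly "nonzero" means
  "not almost everywhere zero".
\<close>

text \<open>Real powers are not available on \<^typ>\<open>ennreal\<close>, hence the case distinction.\<close>

definition Lp_norm :: "real \<Rightarrow> (real ^ 'd \<Rightarrow> real) \<Rightarrow> ennreal" where
  "Lp_norm p f =
     (let I = (\<integral>\<^sup>+ x. ennreal (\<bar>f x\<bar> powr p) \<partial>lebesgue)
      in if I = \<infinity> then \<infinity> else ennreal (enn2real I powr (1 / p)))"

text \<open>The real interval \<open>(a, b)\<close>, whose right end point may be infinite.\<close>

definition open_ivl :: "real \<Rightarrow> ereal \<Rightarrow> real set" where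
  "open_ivl a b = {p. a < p \<and> ereal p < b}"

text \<open>
  A weight on \<open>(a, b)\<close> is represented by a total function; its values outside
  \<open>(a, b)\<close> are irrelevant everywhere below.
\<close>

definition Psi :: "real \<Rightarrow> ereal \<Rightarrow> (real \<Rightarrow> real) set" where
  "Psi a b = {\<psi>. continuous_on (open_ivl a b) \<psi> \<and>
                  (\<forall>p\<in>open_ivl a b. 0 < \<psi> p) \<and>
                  0 < (INF p\<in>open_ivl a b. \<psi> p)}"

text \<open>
  The Grand Lebesgue norm and space for a weight on a set \<open>S\<close> of exponents, to be used
  with \<open>S = (a, b)\<close> for \<open>\<psi>\<close> and \<open>S = (A, B)\<close> for \<open>\<psi>\<^sub>\<theta>\<close>.
\<close>

definition GL_norm :: "real set \<Rightarrow> (real \<Rightarrow> real) \<Rightarrow> (real ^ 'd \<Rightarrow> real) \<Rightarrow> ennreal" where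
  "GL_norm S \<psi> f = (SUP p\<in>S. Lp_norm p f / ennreal (\<psi> p))"

definition GL_space :: "real set \<Rightarrow> (real \<Rightarrow> real) \<Rightarrow> (real ^ 'd \<Rightarrow> real) set" where
  "GL_space S \<psi> = {f. f \<in> borel_measurable lebesgue \<and> GL_norm S \<psi> f < \<infinity>}"

text \<open>At \<open>t = 0\<close> the \<open>powr\<close> below is \<open>0\<close>; this concerns a single point only.\<close>

definition theta :: "nat \<Rightarrow> (real \<Rightarrow> real) \<Rightarrow> real \<Rightarrow> ennreal" where
  "theta d \<phi> p = (\<integral>\<^sup>+ t. ennreal (t powr (- real d / p) * \<phi> t) \<partial>lebesgue_on {0..1})"

definition supp_theta :: "nat \<Rightarrow> (real \<Rightarrow> real) \<Rightarrow> real set" where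
  "supp_theta d \<phi> = {p. 1 \<le> p \<and> theta d \<phi> p < \<infinity>}"

text \<open>
  The Bochner integral is \<open>0\<close> by convention where the integrand is not integrable,
  so statements about \<open>U\<close> have to assert integrability separately.
\<close>

definition U :: "(real \<Rightarrow> real) \<Rightarrow> (real ^ 'd \<Rightarrow> real) \<Rightarrow> real ^ 'd \<Rightarrow> real" where
  "U \<phi> f x = (\<integral>t. f (t *\<^sub>R x) * \<phi> t \<partial>lebesgue_on {0..1})"

definition admissible :: "nat \<Rightarrow> (real \<Rightarrow> real) \<Rightarrow> real \<Rightarrow> ereal \<Rightarrow> (real \<Rightarrow> real) \<Rightarrow> bool" where
  "admissible d \<phi> a b \<psi> \<longleftrightarrow>
     1 \<le> a \<and> ereal a < b \<and> \<psi> \<in> Psi a b \<and>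
     is_interval (open_ivl a b \<inter> supp_theta d \<phi>) \<and>
     interior (open_ivl a b \<inter> supp_theta d \<phi>) \<noteq> {}"

text \<open>The interval \<open>(A, B)\<close>.\<close>

definition AB :: "nat \<Rightarrow> (real \<Rightarrow> real) \<Rightarrow> real \<Rightarrow> ereal \<Rightarrow> real set" where
  "AB d \<phi> a b = interior (open_ivl a b \<inter> supp_theta d \<phi>)"

text \<open>Only used on \<open>(A, B)\<close>, where \<open>\<theta>\<close> is finite.\<close>

definition psi_theta :: "nat \<Rightarrow> (real \<Rightarrow> real) \<Rightarrow> (real \<Rightarrow> real) \<Rightarrow> real \<Rightarrow> real" where
  "psi_theta d \<phi> \<psi> p = \<psi> p * enn2real (theta d \<phi> p)"

end

theory Submission
  imports Defs
begin

text \<open>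
  Upper bound. \<open>U \<phi> f\<close> is an average of the dilations \<open>x \<mapsto> f(tx)\<close> with weight \<open>\<phi>(t)\<close>, and a dilation
  by \<open>t\<close> multiplies the \<open>L\<^sup>p\<close> norm by \<open>t\<^bsup>-d/p\<^esup>\<close>. Minkowski's integral inequality therefore
  gives \<open>\<bar>U \<phi> f\<bar>\<^sub>p \<le> \<theta>(p) \<bar>f\<bar>\<^sub>p\<close> (\<open>U_Lp_bound\<close>); dividing by \<open>\<psi>(p) \<theta>(p)\<close> and taking the supremum over
  \<open>p\<close> yields the bound with constant \<open>1\<close> (\<open>GL_norm_U_le\<close>). The inequality is derived from Jensen's
  inequality for the probability measure proportional to \<open>t\<^bsup>-d/p\<^esup> \<phi>(t) dt\<close> and from Tonelli's
  theorem (\<open>nn_integral_power_mean\<close>, \<open>dilation_average_Lp_borel\<close>).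

  Sharpness. The homogeneous function \<open>\<bar>x\<bar>\<^bsup>-d/q\<^esup>\<close> is multiplied by exactly \<open>\<theta>(q)\<close> under \<open>U \<phi>\<close>, but
  fails logarithmically to be in \<open>L\<^sup>q\<close>. Its restriction \<open>f\<close> to the annulus \<open>\<eta>\<^bsup>n+1\<^esup> < \<bar>x\<bar> \<le> 1\<close> has
  \<open>\<bar>f\<bar>\<^sub>q\<^sup>q\<close> proportional to \<open>n + 1\<close> by dilation invariance of \<open>\<bar>x\<bar>\<^bsup>-d\<^esup> dx\<close> (\<open>annulus_mass_power\<close>), and
  \<open>U \<phi> f\<close> is at least \<open>f\<close> times the part of the integral \<open>\<theta>(q)\<close> over \<open>[\<eta>, 1]\<close>, except on one of the
  \<open>n + 1\<close> sub-annuli (\<open>nn_integral_U_annulus_power_ge\<close>). Letting \<open>n \<rightarrow> \<infinity>\<close> and then \<open>\<eta> \<rightarrow> 0\<close> makes the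
  ratio of the \<open>L\<^sup>q\<close> norms tend to \<open>\<theta>(q)\<close>. Since the weight \<open>\<psi>\<close> may depend on \<open>f\<close>, it is chosen so that
  the Grand Lebesgue norm of \<open>f\<close> is controlled by its value at \<open>q\<close> (\<open>annulus_weight\<close>,
  \<open>GL_norm_annulus_power_ratio\<close>), and the ratio of the Grand Lebesgue norms tends to \<open>1\<close>.
\<close>

section \<open>Jensen's inequality and dilations\<close>

text \<open>
  Jensen's inequality for \<open>k \<mapsto> k\<^sup>p\<close> and the finite measure \<open>w dM\<close> of mass \<open>W\<close>. The constant \<open>c\<close>
  in the proof is the \<open>p\<close>-mean of \<open>k\<close>; Young's inequality bounds \<open>k\<close> by the tangent of
  the \<open>p\<close>-th root at \<open>c\<^sup>p\<close>, evaluated at \<open>k\<^sup>p\<close>, and integrating this affine bound in \<open>k\<^sup>p\<close>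
  returns exactly \<open>W c\<close>. In this form finiteness of the left-hand side is a conclusion.
\<close>

lemma nn_integral_power_mean:
  fixes k w :: "'a \<Rightarrow> real"
  assumes [measurable]: "k \<in> borel_measurable M" "w \<in> borel_measurable M"
    and k0: "\<And>t. 0 \<le> k t" and w0: "\<And>t. 0 \<le> w t" and p: "1 \<le> p"
    and W: "(\<integral>\<^sup>+t. ennreal (w t) \<partial>M) = ennreal W" "0 < W"
    and J: "(\<integral>\<^sup>+t. ennreal (k t powr p * w t) \<partial>M) = ennreal J" "0 \<le> J"
  shows "(\<integral>\<^sup>+t. ennreal (k t * w t) \<partial>M) \<le> ennreal (W * (J / W) powr (1 / p))"
proof (cases "J = 0")
  case True
  then have "AE t in M. ennreal (k t powr p * w t) = 0"
    using J by (intro nn_integral_0_iff_AE[THEN iffD1]) auto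
  then have "AE t in M. ennreal (k t * w t) = 0"
  proof eventually_elim
    case (elim t)
    then have "k t powr p * w t = 0"
      using w0[of t] by (metis ennreal_eq_0_iff mult_nonneg_nonneg order_antisym powr_ge_zero)
    then show ?case by auto
  qed
  then have "(\<integral>\<^sup>+t. ennreal (k t * w t) \<partial>M) = 0"
    by (subst nn_integral_0_iff_AE) auto
  then show ?thesis by simp
next
  case False
  define c where "c = (J / W) powr (1 / p)"
  have c: "0 < c" "c powr p = J / W"
    using False J(2) W(2) p by (auto simp: c_def powr_powr)
  have young: "k t \<le> c / (p * c powr p) * k t powr p + c * (1 - 1 / p)" for t
  proof (cases "k t = 0")
    case True
    then show ?thesis using p c by simp
  next
    case False
    then have kt: "0 < k t" using k0[of t] by simp
    have "((k t / c) powr p) powr (1 / p) * 1 powr (1 - 1 / p)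
        \<le> 1 / p * (k t / c) powr p + (1 - 1 / p) * 1"
      using p kt c by (intro Youngs_inequality_0) auto
    then have "k t / c \<le> 1 / p * (k t powr p / c powr p) + (1 - 1 / p)"
      using p kt c(1) by (simp add: powr_powr powr_divide)
    then have "c * (k t / c) \<le> c * (1 / p * (k t powr p / c powr p) + (1 - 1 / p))"
      using c by (intro mult_left_mono) auto
    then show ?thesis using c by (simp add: algebra_simps)
  qed
  let ?u = "c / (p * c powr p)" and ?v = "c * (1 - 1 / p)"
  have uv: "0 \<le> ?u" "0 \<le> ?v"
    using c(1) p by (auto simp del: powr_gt_zero intro!: divide_nonneg_nonneg mult_nonneg_nonneg)
  have "(\<integral>\<^sup>+t. ennreal (k t * w t) \<partial>M)
      \<le> (\<integral>\<^sup>+t. ennreal ?u * ennreal (k t powr p * w t) + ennreal ?v * ennreal (w t) \<partial>M)"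
  proof (rule nn_integral_mono)
    fix t
    have "k t * w t \<le> (?u * k t powr p + ?v) * w t"
      using young w0 by (intro mult_right_mono)
    also have "ennreal \<dots> = ennreal ?u * ennreal (k t powr p * w t) + ennreal ?v * ennreal (w t)"
      using uv w0[of t] by (simp only: distrib_right mult.assoc[of ?u] ennreal_plus
          ennreal_mult[of ?u] ennreal_mult[of ?v] mult_nonneg_nonneg powr_ge_zero)
    finally show "ennreal (k t * w t) \<le>
        ennreal ?u * ennreal (k t powr p * w t) + ennreal ?v * ennreal (w t)"
      by (simp add: ennreal_leI)
  qed
  also have "\<dots> = ennreal ?u * ennreal J + ennreal ?v * ennreal W"
    by (simp add: nn_integral_add nn_integral_cmult J W)
  also have "\<dots> = ennreal (?u * J + ?v * W)"
    using uv J(2) less_imp_le[OF W(2)] by (simp only: ennreal_plus ennreal_mult mult_nonneg_nonneg)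
  also have "?u * J + ?v * W = W * c"
    using c W False p by (simp add: field_simps)
  finally show ?thesis by (simp add: c_def)
qed

lemma nn_integral_scaleR_lborel:
  fixes F :: "'a::euclidean_space \<Rightarrow> ennreal"
  assumes [measurable]: "F \<in> borel_measurable borel" and t: "t \<noteq> 0"
  shows "ennreal (\<bar>t\<bar> ^ DIM('a)) * (\<integral>\<^sup>+x. F (t *\<^sub>R x) \<partial>lborel) = (\<integral>\<^sup>+x. F x \<partial>lborel)"
proof -
  have "(\<integral>\<^sup>+x. F x \<partial>lborel)
      = (\<integral>\<^sup>+x. F x \<partial>density (distr lborel borel (\<lambda>x::'a. 0 + t *\<^sub>R x)) (\<lambda>_. \<bar>t\<bar> ^ DIM('a)))"
    using lborel_affine[of t "0::'a"] t by simp
  also have "\<dots> = (\<integral>\<^sup>+x. ennreal (\<bar>t\<bar> ^ DIM('a)) * F (t *\<^sub>R x) \<partial>lborel)"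
    using t by (simp add: nn_integral_density nn_integral_distr)
  finally show ?thesis by (simp add: nn_integral_cmult)
qed

text \<open>
  The core estimate, with the factor \<open>t\<^bsup>-D/p\<^esup>\<close> that a dilation contributes to an \<open>L\<^sup>p\<close> norm
  moved into the weight: \<open>\<bar>g(tx)\<bar> h(t) = k(x,t) w(t)\<close> with \<open>k(x,t) = \<bar>g(tx)\<bar> t\<^bsup>D/p\<^esup>\<close> and
  \<open>w(t) = t\<^bsup>-D/p\<^esup> h(t)\<close>. For every \<open>t > 0\<close> the function \<open>x \<mapsto> k(x,t)\<close> then has the same
  \<open>L\<^sup>p\<close> norm as \<open>g\<close>, so that Jensen's inequality in \<open>t\<close> followed by Tonelli loses nothing.
\<close>

lemma dilation_average_Lp_borel:
  fixes g :: "'a::euclidean_space \<Rightarrow> real" and h :: "real \<Rightarrow> real"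
  assumes [measurable]: "g \<in> borel_measurable borel" "h \<in> borel_measurable borel"
    and h0: "\<And>t. 0 \<le> h t" "\<And>t. t \<le> 0 \<Longrightarrow> h t = 0" and p: "1 \<le> p"
    and W: "(\<integral>\<^sup>+t. ennreal (t powr (- real DIM('a) / p) * h t) \<partial>lborel) = ennreal W" "0 < W"
    and I: "(\<integral>\<^sup>+x. ennreal (\<bar>g x\<bar> powr p) \<partial>lborel) < \<infinity>"
  defines "K \<equiv> \<lambda>x. \<integral>\<^sup>+t. ennreal (\<bar>g (t *\<^sub>R x)\<bar> * h t) \<partial>lborel"
  shows "AE x in lborel. K x < \<infinity>"
    and "(\<integral>\<^sup>+x. ennreal (enn2real (K x) powr p) \<partial>lborel)
        \<le> ennreal (W powr p) * (\<integral>\<^sup>+x. ennreal (\<bar>g x\<bar> powr p) \<partial>lborel)"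
proof -
  let ?D = "real DIM('a)"
  define w where "w t = t powr (- ?D / p) * h t" for t
  define k where "k x t = \<bar>g (t *\<^sub>R x)\<bar> * t powr (?D / p)" for x t
  have w0: "0 \<le> w t" and k0: "0 \<le> k x t" for x t using h0 by (auto simp: w_def k_def)
  have [measurable]: "w \<in> borel_measurable borel" unfolding w_def by measurable
  have [measurable]: "(\<lambda>(x, t). k x t) \<in> borel_measurable (borel \<Otimes>\<^sub>M borel)"
    unfolding k_def by measurable
  define J where "J x = (\<integral>\<^sup>+t. ennreal (k x t powr p * w t) \<partial>lborel)" for x
  have [measurable]: "J \<in> borel_measurable borel" unfolding J_def by measurable
  have kw: "k x t * w t = \<bar>g (t *\<^sub>R x)\<bar> * h t" for x t
    using h0(2)[of t] by (cases "t \<le> 0") (auto simp: k_def w_def powr_minus field_simps)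
  have Keq: "K x = (\<integral>\<^sup>+t. ennreal (k x t * w t) \<partial>lborel)" for x
    by (simp add: K_def kw)
  \<comment> \<open>Tonelli; by the scaling rule each dilation contributes the same integral of \<open>\<bar>g\<bar>\<^sup>p\<close>.\<close>
  have "(\<integral>\<^sup>+x. J x \<partial>lborel) = (\<integral>\<^sup>+t. \<integral>\<^sup>+x. ennreal (k x t powr p * w t) \<partial>lborel \<partial>lborel)"
    unfolding J_def by (rule lborel_pair.Fubini'[symmetric]) measurable
  also have "\<dots> = (\<integral>\<^sup>+t. ennreal (w t) * (\<integral>\<^sup>+x. ennreal (\<bar>g x\<bar> powr p) \<partial>lborel) \<partial>lborel)"
  proof (rule nn_integral_cong)
    fix t :: real
    show "(\<integral>\<^sup>+x. ennreal (k x t powr p * w t) \<partial>lborel)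
        = ennreal (w t) * (\<integral>\<^sup>+x. ennreal (\<bar>g x\<bar> powr p) \<partial>lborel)"
    proof (cases "t \<le> 0")
      case True
      then show ?thesis using h0(2)[of t] by (simp add: w_def)
    next
      case False
      then have t: "0 < t" by simp
      have "ennreal (k x t powr p * w t)
          = ennreal (w t) * (ennreal (t ^ DIM('a)) * ennreal (\<bar>g (t *\<^sub>R x)\<bar> powr p))" for x
        using t p w0[of t] by (simp add: k_def powr_mult powr_powr powr_realpow ennreal_mult'[symmetric] mult_ac)
      then have "(\<integral>\<^sup>+x. ennreal (k x t powr p * w t) \<partial>lborel)
          = ennreal (w t) * (ennreal (t ^ DIM('a)) * (\<integral>\<^sup>+x. ennreal (\<bar>g (t *\<^sub>R x)\<bar> powr p) \<partial>lborel))"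
        by (simp add: nn_integral_cmult)
      also have "ennreal (t ^ DIM('a)) * (\<integral>\<^sup>+x. ennreal (\<bar>g (t *\<^sub>R x)\<bar> powr p) \<partial>lborel)
          = (\<integral>\<^sup>+x. ennreal (\<bar>g x\<bar> powr p) \<partial>lborel)"
        using nn_integral_scaleR_lborel[of "\<lambda>x. ennreal (\<bar>g x\<bar> powr p)" t] t by simp
      finally show ?thesis .
    qed
  qed
  also have "\<dots> = ennreal W * (\<integral>\<^sup>+x. ennreal (\<bar>g x\<bar> powr p) \<partial>lborel)"
    using W by (simp add: nn_integral_multc w_def)
  finally have intJ: "(\<integral>\<^sup>+x. J x \<partial>lborel) = ennreal W * (\<integral>\<^sup>+x. ennreal (\<bar>g x\<bar> powr p) \<partial>lborel)" .
  have "AE x in lborel. J x \<noteq> \<infinity>"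
    using I by (intro nn_integral_PInf_AE) (auto simp: intJ ennreal_mult_eq_top_iff)
  then have J_fin: "AE x in lborel. J x < \<infinity>" by (simp add: less_top)
  have K_le: "K x \<le> ennreal (W * (enn2real (J x) / W) powr (1 / p))" if "J x < \<infinity>" for x
    unfolding Keq
  proof (rule nn_integral_power_mean[OF _ _ k0 w0 p _ W(2)])
    show "(\<integral>\<^sup>+t. ennreal (w t) \<partial>lborel) = ennreal W" using W by (simp add: w_def)
    show "(\<integral>\<^sup>+t. ennreal (k x t powr p * w t) \<partial>lborel) = ennreal (enn2real (J x))"
      using that by (simp add: J_def[symmetric])
  qed (use k0 in auto)
  show "AE x in lborel. K x < \<infinity>"
    using J_fin by eventually_elim (use K_le in \<open>force simp: le_less_trans[OF _ ennreal_less_top]\<close>)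
  have "(\<integral>\<^sup>+x. ennreal (enn2real (K x) powr p) \<partial>lborel)
      \<le> (\<integral>\<^sup>+x. ennreal (W powr (p - 1)) * J x \<partial>lborel)"
  proof (rule nn_integral_mono_AE, use J_fin in eventually_elim)
    case (elim x)
    have "enn2real (K x) \<le> W * (enn2real (J x) / W) powr (1 / p)"
      using K_le[OF elim] W by (intro enn2real_leI) auto
    then have "enn2real (K x) powr p \<le> (W * (enn2real (J x) / W) powr (1 / p)) powr p"
      using p by (intro powr_mono2) auto
    also have "\<dots> = W powr (p - 1) * enn2real (J x)"
      using W p by (simp add: powr_mult powr_powr powr_diff)
    finally have "ennreal (enn2real (K x) powr p) \<le> ennreal (W powr (p - 1) * enn2real (J x))"
      by (rule ennreal_leI)
    then show ?case using elim by (simp add: ennreal_mult)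
  qed
  also have "\<dots> = ennreal (W powr (p - 1) * W) * (\<integral>\<^sup>+x. ennreal (\<bar>g x\<bar> powr p) \<partial>lborel)"
    using W by (simp add: nn_integral_cmult intJ ennreal_mult mult.assoc)
  also have "W powr (p - 1) * W = W powr p"
    using W by (simp add: powr_diff)
  finally show "(\<integral>\<^sup>+x. ennreal (enn2real (K x) powr p) \<partial>lborel)
        \<le> ennreal (W powr p) * (\<integral>\<^sup>+x. ennreal (\<bar>g x\<bar> powr p) \<partial>lborel)" .
qed

section \<open>Passing from Lebesgue to Borel measurable functions\<close>

lemma borel_measurable_lebesgue_cong_AE:
  fixes f g :: "'a::euclidean_space \<Rightarrow> real"
  assumes f: "f \<in> borel_measurable lebesgue" and eq: "AE x in lebesgue. f x = g x"
  shows "g \<in> borel_measurable lebesgue"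
proof (rule measurableI)
  fix A :: "real set" assume "A \<in> sets borel"
  then have "f -` A \<inter> space lebesgue \<in> sets lebesgue" using f by (rule measurable_sets[rotated])
  moreover have "AE x in lebesgue. x \<in> f -` A \<inter> space lebesgue \<longleftrightarrow> x \<in> g -` A \<inter> space lebesgue"
    using eq by eventually_elim simp
  ultimately show "g -` A \<inter> space lebesgue \<in> sets lebesgue"
    using completion.in_sets_AE[of "f -` A \<inter> space lebesgue" "g -` A \<inter> space lebesgue" lborel] by blast
qed simp

text \<open>
  A Lebesgue measurable \<open>f\<close> need not yield a Borel function \<open>(t, x) \<mapsto> f(tx)\<close>, and Tonelli is
  applied to a Borel version of \<open>f\<close>. This lemma justifies the replacement inside the integral
  over \<open>t\<close>: each dilation with \<open>t \<noteq> 0\<close> preserves null sets, and the order of the two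
  \<open>almost everywhere\<close> quantifiers can be exchanged.
\<close>

lemma AE_dilation:
  fixes P :: "'a::euclidean_space \<Rightarrow> bool"
  assumes "AE y in lborel. P y"
  shows "AE x in lborel. AE t in lborel. P (t *\<^sub>R x)"
proof -
  obtain N where N: "{y \<in> space lborel. \<not> P y} \<subseteq> N" "emeasure lborel N = 0" "N \<in> sets lborel"
    using assms by (rule AE_E)
  then have [measurable]: "N \<in> sets borel" by simp
  have "AE t in lborel. t \<noteq> (0::real)"
    by (rule AE_lborel_singleton)
  then have "AE t in lborel. AE x in lborel. t *\<^sub>R x \<notin> N"
  proof eventually_elim
    case (elim t)
    have "ennreal (\<bar>t\<bar> ^ DIM('a)) * (\<integral>\<^sup>+x. indicator N (t *\<^sub>R x) \<partial>lborel) = 0"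
      using nn_integral_scaleR_lborel[of "indicator N" t] elim N by simp
    then have "(\<integral>\<^sup>+x. indicator N (t *\<^sub>R x) \<partial>lborel) = 0"
      using elim by simp
    then have "AE x in lborel. indicator N (t *\<^sub>R x) = (0::ennreal)"
      by (intro nn_integral_0_iff_AE[THEN iffD1]) auto
    then show ?case by eventually_elim (simp add: indicator_def split: if_splits)
  qed
  moreover have "(\<lambda>z. snd z *\<^sub>R fst z) -` (- N) \<inter> space (lborel \<Otimes>\<^sub>M lborel)
      \<in> sets (lborel \<Otimes>\<^sub>M (lborel :: real measure))"
    by (rule measurable_sets[where A = borel]) auto
  ultimately have "AE x in lborel. AE t in lborel. t *\<^sub>R x \<notin> N"
    by (subst lborel_pair.AE_commute) (auto simp: vimage_def Int_def conj_commute)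
  then show ?thesis
  proof eventually_elim
    case (elim x)
    then show ?case by eventually_elim (use N in auto)
  qed
qed

text \<open>
  The point \<open>t = 0\<close> is discarded, because dilation by \<open>0\<close> collapses the space and
  \<open>0 powr a = 0\<close> would break the identities between powers of \<open>t\<close>.
\<close>

lemma weight_borel_representative:
  fixes \<phi> :: "real \<Rightarrow> real"
  assumes \<phi>: "\<phi> \<in> borel_measurable (lebesgue_on {0..1})" "\<And>t. t \<in> {0..1} \<Longrightarrow> 0 \<le> \<phi> t"
  obtains h where "h \<in> borel_measurable borel" "\<And>t. 0 \<le> h t" "\<And>t. t \<le> 0 \<Longrightarrow> h t = 0"
    "AE t in lborel. indicator {0..1} t * \<phi> t = h t"
proof -
  have "(\<lambda>t. indicator {0..1} t * \<phi> t) \<in> borel_measurable lebesgue"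
    using \<phi>(1) by (subst (asm) borel_measurable_restrict_space_iff) auto
  then obtain h0 where h0: "h0 \<in> borel_measurable lborel"
      "AE t in lborel. indicator {0..1} t * \<phi> t = h0 t"
    by (auto dest: completion_ex_borel_measurable_real)
  have [measurable]: "h0 \<in> borel_measurable borel" using h0(1) by simp
  show thesis
  proof (rule that)
    show "(\<lambda>t. indicator {0<..} t * max 0 (h0 t)) \<in> borel_measurable borel" by measurable
    show "AE t in lborel. indicator {0..1} t * \<phi> t = indicator {0<..} t * max 0 (h0 t)"
      using h0(2) AE_lborel_singleton[of "0::real"]
    proof eventually_elim
      case (elim t)
      then show ?case using \<phi>(2)[of t] by (cases "t \<in> {0..1}") auto
    qed
  qed (auto simp: indicator_def)
qed

lemma theta_eq_lborel:
  assumes "AE t in lborel. indicator {0..1} t * \<phi> t = h t"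
  shows "theta d \<phi> p = (\<integral>\<^sup>+t. ennreal (t powr (- real d / p) * h t) \<partial>lborel)"
proof -
  have "theta d \<phi> p
      = (\<integral>\<^sup>+t. ennreal (t powr (- real d / p) * \<phi> t) * indicator {0..1} t \<partial>lebesgue)"
    unfolding theta_def by (subst nn_integral_restrict_space) auto
  also have "\<dots> = (\<integral>\<^sup>+t. ennreal (t powr (- real d / p) * h t) \<partial>lebesgue)"
    by (rule nn_integral_cong_AE, rule AE_completion, use assms in eventually_elim)
       (auto simp: indicator_def split: if_splits)
  finally show ?thesis by (simp add: nn_integral_completion)
qed

lemma theta_pos:
  assumes "\<phi> \<in> borel_measurable (lebesgue_on {0..1})" "\<And>t. t \<in> {0..1} \<Longrightarrow> 0 \<le> \<phi> t"
    and "\<not> (AE t in lebesgue_on {0..1}. \<phi> t = 0)"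
  shows "0 < theta d \<phi> p"
proof (rule ccontr)
  obtain h where h: "h \<in> borel_measurable borel" "\<And>t. 0 \<le> h t" "\<And>t. t \<le> 0 \<Longrightarrow> h t = 0"
    "AE t in lborel. indicator {0..1} t * \<phi> t = h t"
    using weight_borel_representative[OF assms(1,2)] by blast
  note [measurable] = h(1)
  assume "\<not> 0 < theta d \<phi> p"
  then have "(\<integral>\<^sup>+t. ennreal (t powr (- real d / p) * h t) \<partial>lborel) = 0"
    using theta_eq_lborel[OF h(4)] by simp
  then have "AE t in lborel. ennreal (t powr (- real d / p) * h t) = 0"
    by (intro nn_integral_0_iff_AE[THEN iffD1]) auto
  with h(4) have "AE t in lborel. t \<in> {0..1} \<longrightarrow> \<phi> t = 0"
  proof eventually_elim
    case (elim t)
    then have "h t = 0"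
      using h(2,3)[of t] by (cases "t \<le> 0") (auto simp: ennreal_eq_0_iff mult_le_0_iff)
    then show ?case using elim by (auto simp: indicator_def)
  qed
  then have "AE t in lebesgue_on {0..1}. \<phi> t = 0"
    by (subst AE_restrict_space_iff) (auto intro: AE_completion)
  then show False using assms(3) by blast
qed

section \<open>The Lp estimate for U\<close>

lemma Lp_norm_lborel:
  "Lp_norm p f = (let I = (\<integral>\<^sup>+ x. ennreal (\<bar>f x\<bar> powr p) \<partial>lborel)
      in if I = \<infinity> then \<infinity> else ennreal (enn2real I powr (1 / p)))"
  by (simp add: Lp_norm_def nn_integral_completion)

lemma Lp_norm_cong_AE:
  assumes "AE x in lborel. f x = g x"
  shows "Lp_norm p f = Lp_norm p g"
proof -
  have "(\<integral>\<^sup>+ x. ennreal (\<bar>f x\<bar> powr p) \<partial>lborel) = (\<integral>\<^sup>+ x. ennreal (\<bar>g x\<bar> powr p) \<partial>lborel)"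
    by (rule nn_integral_cong_AE) (use assms in eventually_elim, simp)
  then show ?thesis by (simp add: Lp_norm_lborel)
qed

lemma Lp_norm_le_iff:
  assumes "0 < p" "0 \<le> r"
  shows "Lp_norm p f \<le> ennreal r \<longleftrightarrow> (\<integral>\<^sup>+ x. ennreal (\<bar>f x\<bar> powr p) \<partial>lborel) \<le> ennreal (r powr p)"
proof (cases "\<integral>\<^sup>+ x. ennreal (\<bar>f x\<bar> powr p) \<partial>lborel")
  case (real I)
  have "I powr (1 / p) \<le> r \<longleftrightarrow> I \<le> r powr p"
  proof
    assume "I powr (1 / p) \<le> r"
    then have "(I powr (1 / p)) powr p \<le> r powr p" using assms by (intro powr_mono2) auto
    then show "I \<le> r powr p" using assms real by (simp add: powr_powr)
  next
    assume "I \<le> r powr p"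
    then have "I powr (1 / p) \<le> (r powr p) powr (1 / p)" using assms real by (intro powr_mono2) auto
    then show "I powr (1 / p) \<le> r" using assms by (simp add: powr_powr)
  qed
  then show ?thesis using real assms by (simp add: Lp_norm_lborel)
next
  case top
  then show ?thesis by (simp add: Lp_norm_lborel top_unique)
qed

lemma ennreal_le_Lp_norm_iff:
  assumes "0 < p" "0 \<le> r"
  shows "ennreal r \<le> Lp_norm p f \<longleftrightarrow> ennreal (r powr p) \<le> (\<integral>\<^sup>+ x. ennreal (\<bar>f x\<bar> powr p) \<partial>lborel)"
proof (cases "\<integral>\<^sup>+ x. ennreal (\<bar>f x\<bar> powr p) \<partial>lborel")
  case (real I)
  have "r \<le> I powr (1 / p) \<longleftrightarrow> r powr p \<le> I"
  proof
    assume "r \<le> I powr (1 / p)"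
    then have "r powr p \<le> (I powr (1 / p)) powr p" using assms by (intro powr_mono2) auto
    then show "r powr p \<le> I" using assms real by (simp add: powr_powr)
  next
    assume "r powr p \<le> I"
    then have "(r powr p) powr (1 / p) \<le> I powr (1 / p)" using assms real by (intro powr_mono2) auto
    then show "r \<le> I powr (1 / p)" using assms by (simp add: powr_powr)
  qed
  then show ?thesis using real assms by (simp add: Lp_norm_lborel)
next
  case top
  then show ?thesis by (simp add: Lp_norm_lborel)
qed

text \<open>
  Minkowski's integral inequality for the average of the dilations of \<open>f\<close>, together with the
  convergence of the integral that defines \<open>U \<phi> f x\<close> for almost every \<open>x\<close>. Both come from the
  Borel estimate, applied to Borel versions \<open>g\<close> of \<open>f\<close> and \<open>h\<close> of \<open>\<phi>\<close>.
\<close>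

proposition U_Lp_bound:
  fixes f :: "real ^ 'd \<Rightarrow> real" and \<phi> :: "real \<Rightarrow> real"
  assumes \<phi>: "\<phi> \<in> borel_measurable (lebesgue_on {0..1})" "\<And>t. t \<in> {0..1} \<Longrightarrow> 0 \<le> \<phi> t"
    "\<not> (AE t in lebesgue_on {0..1}. \<phi> t = 0)"
    and p: "1 \<le> p" and \<theta>: "theta CARD('d) \<phi> p < \<infinity>"
    and f: "f \<in> borel_measurable lebesgue" "Lp_norm p f < \<infinity>"
  shows "AE x in lebesgue. integrable (lebesgue_on {0..1}) (\<lambda>t. f (t *\<^sub>R x) * \<phi> t)"
    and "U \<phi> f \<in> borel_measurable lebesgue"
    and "Lp_norm p (U \<phi> f) \<le> theta CARD('d) \<phi> p * Lp_norm p f"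
proof -
  obtain h where h: "h \<in> borel_measurable borel" "\<And>t. 0 \<le> h t" "\<And>t. t \<le> 0 \<Longrightarrow> h t = 0"
    "AE t in lborel. indicator {0..1} t * \<phi> t = h t"
    using weight_borel_representative[OF \<phi>(1,2)] by blast
  obtain g where g: "g \<in> borel_measurable lborel" "AE x in lborel. f x = g x"
    using completion_ex_borel_measurable_real[OF f(1)] by auto
  have [measurable]: "h \<in> borel_measurable borel" "g \<in> borel_measurable borel" using h g by auto
  obtain W where W: "theta CARD('d) \<phi> p = ennreal W" "0 < W"
    using \<theta> theta_pos[OF \<phi>, of "CARD('d)" p] by (cases "theta CARD('d) \<phi> p") auto
  define V where "V x = (\<integral>t. g (t *\<^sub>R x) * h t \<partial>lborel)" for x
  have [measurable]: "V \<in> borel_measurable borel" unfolding V_def by measurable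
  define K where "K x = (\<integral>\<^sup>+t. ennreal (\<bar>g (t *\<^sub>R x)\<bar> * h t) \<partial>lborel)" for x
  define I where "I = (\<integral>\<^sup>+ x. ennreal (\<bar>g x\<bar> powr p) \<partial>lborel)"
  have Lp_fg: "Lp_norm p f = Lp_norm p g" by (rule Lp_norm_cong_AE) (rule g)
  have I: "I < \<infinity>"
    using f(2)[unfolded Lp_fg, unfolded Lp_norm_lborel, folded I_def]
    by (simp add: Let_def less_top split: if_splits)
  have W': "(\<integral>\<^sup>+t. ennreal (t powr (- real DIM(real ^ 'd) / p) * h t) \<partial>lborel) = ennreal W"
    using W theta_eq_lborel[OF h(4), of "CARD('d)" p] by simp
  have K_fin: "AE x in lborel. K x < \<infinity>" and K_le: "(\<integral>\<^sup>+x. ennreal (enn2real (K x) powr p) \<partial>lborel)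
        \<le> ennreal (W powr p) * I"
    using dilation_average_Lp_borel[of g h p W] h(2,3) p W' W(2) I
    unfolding K_def I_def by auto
  have eq: "AE x in lborel. AE t in lborel. indicator {0..1} t * (f (t *\<^sub>R x) * \<phi> t) = g (t *\<^sub>R x) * h t"
    using AE_dilation[OF g(2)]
  proof eventually_elim
    case (elim x)
    from this h(4) show ?case
    proof eventually_elim
      case (elim t)
      then show ?case by (metis mult.left_commute)
    qed
  qed
  have int_iff: "AE x in lborel. integrable (lebesgue_on {0..1}) (\<lambda>t. f (t *\<^sub>R x) * \<phi> t)
      \<and> U \<phi> f x = V x \<and> \<bar>V x\<bar> \<le> enn2real (K x)"
    using eq K_fin
  proof eventually_elim
    case (elim x)
    have meas: "(\<lambda>t. g (t *\<^sub>R x) * h t) \<in> borel_measurable lborel" by measurable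
    have int: "integrable lborel (\<lambda>t. g (t *\<^sub>R x) * h t)"
      using elim(2) h(2) unfolding K_def by (intro integrableI_bounded) (auto simp: abs_mult)
    have eq': "AE t in lebesgue. g (t *\<^sub>R x) * h t = indicator {0..1} t *\<^sub>R (f (t *\<^sub>R x) * \<phi> t)"
      by (rule AE_completion) (use elim(1) in eventually_elim, simp)
    have int': "integrable lebesgue (\<lambda>t. g (t *\<^sub>R x) * h t)"
      using int integrable_completion[OF meas] by simp
    have meas': "(\<lambda>t. indicator {0..1} t *\<^sub>R (f (t *\<^sub>R x) * \<phi> t)) \<in> borel_measurable lebesgue"
      using borel_measurable_integrable[OF int'] eq' by (rule borel_measurable_lebesgue_cong_AE)
    have int'': "integrable lebesgue (\<lambda>t. indicator {0..1} t *\<^sub>R (f (t *\<^sub>R x) * \<phi> t))"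
      by (rule integrable_cong_AE_imp[OF int' meas' eq'])
    have "U \<phi> f x = (\<integral>t. indicator {0..1} t *\<^sub>R (f (t *\<^sub>R x) * \<phi> t) \<partial>lebesgue)"
      unfolding U_def by (subst integral_restrict_space) auto
    also have "\<dots> = (\<integral>t. g (t *\<^sub>R x) * h t \<partial>lebesgue)"
      using eq' meas' borel_measurable_integrable[OF int'] by (intro integral_cong_AE) auto
    also have "\<dots> = V x" unfolding V_def by (rule integral_completion[OF meas])
    finally have "U \<phi> f x = V x" .
    moreover have "\<bar>V x\<bar> \<le> enn2real (K x)"
    proof -
      have "ennreal \<bar>V x\<bar> \<le> K x"
        using integral_norm_bound_ennreal[OF int] h(2) by (simp add: V_def K_def abs_mult)
      then have "enn2real (ennreal \<bar>V x\<bar>) \<le> enn2real (K x)"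
        using elim(2) by (intro enn2real_mono) auto
      then show ?thesis by simp
    qed
    ultimately show ?case using int'' by (subst integrable_restrict_space) auto
  qed
  show "AE x in lebesgue. integrable (lebesgue_on {0..1}) (\<lambda>t. f (t *\<^sub>R x) * \<phi> t)"
    by (rule AE_completion) (use int_iff in eventually_elim, simp)
  have UV: "AE x in lborel. U \<phi> f x = V x" using int_iff by eventually_elim simp
  have VU: "AE x in lebesgue. V x = U \<phi> f x"
    by (rule AE_completion) (use UV in eventually_elim, simp)
  have "V \<in> borel_measurable lebesgue" by (simp add: measurable_completion)
  then show "U \<phi> f \<in> borel_measurable lebesgue"
    using VU by (rule borel_measurable_lebesgue_cong_AE)
  define r where "r = enn2real I powr (1 / p)"
  have r: "Lp_norm p g = ennreal r" "0 \<le> r" "ennreal (r powr p) = I"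
    using I p by (auto simp: Lp_norm_lborel I_def[symmetric] r_def powr_powr)
  have "(\<integral>\<^sup>+ x. ennreal (\<bar>V x\<bar> powr p) \<partial>lborel) \<le> (\<integral>\<^sup>+x. ennreal (enn2real (K x) powr p) \<partial>lborel)"
    by (rule nn_integral_mono_AE, use int_iff in eventually_elim)
       (use p in \<open>auto intro!: ennreal_leI powr_mono2\<close>)
  also have "\<dots> \<le> ennreal (W powr p) * I" by (rule K_le)
  also have "\<dots> = ennreal ((W * r) powr p)"
    using r W by (simp add: powr_mult ennreal_mult)
  finally have "Lp_norm p V \<le> ennreal (W * r)"
    using p r W by (subst Lp_norm_le_iff) auto
  then show "Lp_norm p (U \<phi> f) \<le> theta CARD('d) \<phi> p * Lp_norm p f"
    using r W by (simp add: Lp_norm_cong_AE[OF UV] Lp_fg ennreal_mult)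
qed

text \<open>
  At each exponent the factor \<open>theta\<close> gained by \<open>U \<phi> f\<close> cancels against the one in
  \<open>psi_theta\<close>. Since \<open>(A, B)\<close> is non-empty, a single exponent in it also settles
  integrability and measurability.
\<close>

lemma GL_norm_U_le:
  fixes f :: "real ^ 'd \<Rightarrow> real" and \<phi> :: "real \<Rightarrow> real"
  assumes \<phi>: "\<phi> \<in> borel_measurable (lebesgue_on {0..1})" "\<And>t. t \<in> {0..1} \<Longrightarrow> 0 \<le> \<phi> t"
    "\<not> (AE t in lebesgue_on {0..1}. \<phi> t = 0)"
    and adm: "admissible CARD('d) \<phi> a b \<psi>" and f: "f \<in> GL_space (open_ivl a b) \<psi>"
  shows "AE x in lebesgue. integrable (lebesgue_on {0..1}) (\<lambda>t. f (t *\<^sub>R x) * \<phi> t)"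
    and "U \<phi> f \<in> borel_measurable lebesgue"
    and "GL_norm (AB CARD('d) \<phi> a b) (psi_theta CARD('d) \<phi> \<psi>) (U \<phi> f) \<le> GL_norm (open_ivl a b) \<psi> f"
proof -
  have meas: "f \<in> borel_measurable lebesgue" and N: "GL_norm (open_ivl a b) \<psi> f < \<infinity>"
    using f by (auto simp: GL_space_def)
  have p: "p \<in> open_ivl a b" "1 \<le> p" "theta CARD('d) \<phi> p < \<infinity>" "0 < \<psi> p" "Lp_norm p f < \<infinity>"
    if "p \<in> AB CARD('d) \<phi> a b" for p
  proof -
    have "p \<in> open_ivl a b \<inter> supp_theta CARD('d) \<phi>"
      using that interior_subset unfolding AB_def by blast
    then show 1: "p \<in> open_ivl a b" "1 \<le> p" "theta CARD('d) \<phi> p < \<infinity>"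
      by (auto simp: supp_theta_def)
    show 2: "0 < \<psi> p" using adm 1 by (auto simp: admissible_def Psi_def)
    have "Lp_norm p f / ennreal (\<psi> p) < \<infinity>"
      using N SUP_upper[OF 1(1), of "\<lambda>p. Lp_norm p f / ennreal (\<psi> p)"]
      unfolding GL_norm_def by (rule le_less_trans[rotated])
    then show "Lp_norm p f < \<infinity>"
      using 2 by (simp add: ennreal_divide_eq_top_iff less_top[symmetric])
  qed
  obtain p where "p \<in> AB CARD('d) \<phi> a b"
    using adm by (auto simp: admissible_def AB_def)
  from U_Lp_bound(1,2)[OF \<phi> p(2,3)[OF this] meas p(5)[OF this]]
  show "AE x in lebesgue. integrable (lebesgue_on {0..1}) (\<lambda>t. f (t *\<^sub>R x) * \<phi> t)"
    and "U \<phi> f \<in> borel_measurable lebesgue" by auto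
  show "GL_norm (AB CARD('d) \<phi> a b) (psi_theta CARD('d) \<phi> \<psi>) (U \<phi> f) \<le> GL_norm (open_ivl a b) \<psi> f"
    unfolding GL_norm_def[of "AB CARD('d) \<phi> a b"]
  proof (rule SUP_least)
    fix p assume "p \<in> AB CARD('d) \<phi> a b"
    note p = p[OF this]
    obtain W where W: "theta CARD('d) \<phi> p = ennreal W" "0 < W"
      using p(3) theta_pos[OF \<phi>, of "CARD('d)" p] by (cases "theta CARD('d) \<phi> p") auto
    obtain r where r: "Lp_norm p f = ennreal r" "0 \<le> r"
      using p(5) by (cases "Lp_norm p f") auto
    have "Lp_norm p (U \<phi> f) / ennreal (psi_theta CARD('d) \<phi> \<psi> p)
        \<le> theta CARD('d) \<phi> p * Lp_norm p f / ennreal (\<psi> p * W)"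
      using U_Lp_bound(3)[OF \<phi> p(2,3) meas p(5)] W
      by (simp add: psi_theta_def divide_right_mono_ennreal)
    also have "\<dots> = Lp_norm p f / ennreal (\<psi> p)"
      using W r p(4) by (simp add: ennreal_mult'[symmetric] divide_ennreal)
    also have "\<dots> \<le> GL_norm (open_ivl a b) \<psi> f"
      unfolding GL_norm_def using p(1) by (intro SUP_upper)
    finally show "Lp_norm p (U \<phi> f) / ennreal (psi_theta CARD('d) \<phi> \<psi> p) \<le> GL_norm (open_ivl a b) \<psi> f" .
  qed
qed

section \<open>Truncated homogeneous functions\<close>

text \<open>
  The function \<open>\<bar>x\<bar>\<^bsup>-d/q\<^esup>\<close>, a formal eigenfunction of \<open>U \<phi>\<close> with eigenvalue \<open>theta\<close> at \<open>q\<close>,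
  cut off to an annulus in order to lie in \<open>L\<^sup>q\<close>.
\<close>

definition annulus_power :: "real \<Rightarrow> real \<Rightarrow> real ^ 'd \<Rightarrow> real" where
  "annulus_power q r x = indicator {r<..1} (norm x) * norm x powr (- real CARD('d) / q)"

definition annulus_mass :: "'d::finite itself \<Rightarrow> real \<Rightarrow> ennreal" where
  "annulus_mass _ r =
     (\<integral>\<^sup>+x. ennreal (indicator {r<..1} (norm (x :: real ^ 'd)) * norm x powr (- real CARD('d))) \<partial>lborel)"

lemma annulus_power_measurable [measurable]: "annulus_power q r \<in> borel_measurable borel"
  unfolding annulus_power_def by measurable

lemma nn_integral_annulus_power:
  assumes "0 < q"
  shows "(\<integral>\<^sup>+x. ennreal (\<bar>annulus_power q r (x :: real ^ 'd)\<bar> powr q) \<partial>lborel) = annulus_mass TYPE('d) r"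
  unfolding annulus_mass_def annulus_power_def
  by (intro nn_integral_cong) (use assms in \<open>auto simp: indicator_def powr_powr\<close>)

text \<open>
  The measure \<open>\<bar>x\<bar>\<^bsup>-d\<^esup> dx\<close> is invariant under dilations, so each of the \<open>n\<close> annuli
  \<open>\<eta>\<^bsup>k+1\<^esup> < \<bar>x\<bar> \<le> \<eta>\<^sup>k\<close> has the same mass. Hence the innermost annulus carries only the
  fraction \<open>1/n\<close> of the total, which makes its loss negligible later on, and no polar
  coordinates are involved.
\<close>

lemma annulus_mass_power:
  assumes "0 < \<eta>" "\<eta> < 1"
  shows "annulus_mass TYPE('d::finite) (\<eta> ^ n) = of_nat n * annulus_mass TYPE('d) \<eta>"
proof (induction n)
  case 0
  then show ?case by (simp add: annulus_mass_def)
next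
  case (Suc n)
  define F where "F x = ennreal (indicator {\<eta> ^ Suc n<..\<eta>} (norm x) * norm x powr (- real CARD('d)))"
    for x :: "real ^ 'd"
  have [measurable]: "F \<in> borel_measurable borel" unfolding F_def by measurable
  have le: "\<eta> ^ Suc n \<le> \<eta>" using assms by (simp add: mult_left_le power_le_one)
  have split: "indicator {\<eta> ^ Suc n<..1} y = indicator {\<eta> ^ Suc n<..\<eta>} y + (indicator {\<eta><..1} y :: real)"
    for y :: real
    using le assms(2) unfolding indicator_def of_bool_def greaterThanAtMost_iff
    by (smt (verit))
  have "annulus_mass TYPE('d) (\<eta> ^ Suc n)
      = (\<integral>\<^sup>+x. F x + ennreal (indicator {\<eta><..1} (norm x) * norm x powr (- real CARD('d))) \<partial>lborel)"
    unfolding annulus_mass_def F_def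
    by (intro nn_integral_cong) (simp only: split distrib_right ennreal_plus mult_nonneg_nonneg
        indicator_pos_le powr_ge_zero)
  also have "\<dots> = (\<integral>\<^sup>+x. F x \<partial>lborel) + annulus_mass TYPE('d) \<eta>"
    by (simp add: nn_integral_add annulus_mass_def)
  also have "(\<integral>\<^sup>+x. F x \<partial>lborel)
      = (\<integral>\<^sup>+x. ennreal (\<bar>\<eta>\<bar> ^ CARD('d)) * F (\<eta> *\<^sub>R x) \<partial>lborel)"
    using assms nn_integral_scaleR_lborel[of F \<eta>] by (simp add: nn_integral_cmult)
  also have "\<dots> = annulus_mass TYPE('d) (\<eta> ^ n)"
    unfolding annulus_mass_def
  proof (rule nn_integral_cong)
    fix x :: "real ^ 'd"
    have "norm (\<eta> *\<^sub>R x) \<in> {\<eta> ^ Suc n<..\<eta>} \<longleftrightarrow> norm x \<in> {\<eta> ^ n<..1}"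
      using assms by auto
    moreover have "\<eta> ^ CARD('d) * norm (\<eta> *\<^sub>R x) powr (- real CARD('d)) = norm x powr (- real CARD('d))"
      using assms by (simp add: powr_mult powr_minus powr_realpow)
    ultimately show "ennreal (\<bar>\<eta>\<bar> ^ CARD('d)) * F (\<eta> *\<^sub>R x)
        = ennreal (indicator {\<eta> ^ n<..1} (norm x) * norm x powr (- real CARD('d)))"
      using assms unfolding F_def
      by (simp add: ennreal_mult'[symmetric] indicator_def del: norm_scaleR)
  qed
  finally show ?case using Suc by (simp add: distrib_right add.commute)
qed

lemma annulus_mass_finite:
  assumes "0 < r"
  shows "annulus_mass TYPE('d::finite) r < \<infinity>"
proof -
  have "annulus_mass TYPE('d) r
      \<le> (\<integral>\<^sup>+x. ennreal (r powr (- real CARD('d))) * indicator (cball 0 1) (x :: real ^ 'd) \<partial>lborel)"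
    unfolding annulus_mass_def
    by (intro nn_integral_mono)
       (use assms in \<open>auto simp: indicator_def dist_norm intro!: ennreal_leI powr_mono2'\<close>)
  also have "\<dots> = ennreal (r powr (- real CARD('d))) * emeasure lborel (cball (0 :: real ^ 'd) 1)"
    by (simp add: nn_integral_cmult_indicator)
  also have "\<dots> < \<infinity>"
    using emeasure_bounded_finite[of "cball (0 :: real ^ 'd) 1"] by (simp add: ennreal_mult_less_top)
  finally show ?thesis .
qed

lemma annulus_mass_pos:
  assumes "0 < r" "r < 1"
  shows "0 < annulus_mass TYPE('d::finite) r"
proof (rule ccontr)
  assume "\<not> 0 < annulus_mass TYPE('d) r"
  then have "AE x in lborel. ennreal (indicator {r<..1} (norm x) * norm (x :: real ^ 'd) powr (- real CARD('d))) = 0"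
    unfolding annulus_mass_def by (intro nn_integral_0_iff_AE[THEN iffD1]) auto
  then have "AE x in lborel. (x :: real ^ 'd) \<notin> ball 0 1 - cball 0 r"
    by eventually_elim (use assms in \<open>auto simp: indicator_def split: if_splits\<close>)
  then have "ball 0 1 - cball 0 r \<in> null_sets (lborel :: (real ^ 'd) measure)"
    by (subst AE_iff_null_sets) auto
  then have "negligible (ball 0 1 - cball 0 r :: (real ^ 'd) set)"
    by (simp add: negligible_iff_null_sets null_sets_completionI)
  moreover obtain x :: "real ^ 'd" where "norm x = (r + 1) / 2"
    using vector_choose_size[of "(r + 1) / 2"] assms by auto
  then have "x \<in> ball 0 1 - cball 0 r" using assms by (auto simp: dist_norm)
  ultimately show False
    using open_not_negligible[of "ball 0 1 - cball 0 r :: (real ^ 'd) set"]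
    by (metis closed_cball empty_iff open_Diff open_ball)
qed

section \<open>Monotonicity and truncation of theta\<close>

lemma theta_antimono:
  assumes "\<And>t. t \<in> {0..1} \<Longrightarrow> 0 \<le> \<phi> t" "0 < p" "p \<le> q"
  shows "theta d \<phi> q \<le> theta d \<phi> p"
  unfolding theta_def
proof (rule nn_integral_mono)
  fix t :: real assume "t \<in> space (lebesgue_on {0..1})"
  then have t: "t \<in> {0..1}" by simp
  then have "t powr (- real d / q) \<le> t powr (- real d / p)"
    using assms by (intro powr_mono') (auto simp: frac_le)
  then show "ennreal (t powr (- real d / q) * \<phi> t) \<le> ennreal (t powr (- real d / p) * \<phi> t)"
    using assms t by (intro ennreal_leI mult_right_mono) auto
qed

text \<open>
  The part of \<open>theta\<close> that is visible to \<open>U\<close> acting on a function that vanishes near the origin.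
\<close>

definition truncated_theta :: "nat \<Rightarrow> (real \<Rightarrow> real) \<Rightarrow> real \<Rightarrow> real \<Rightarrow> ennreal" where
  "truncated_theta d \<phi> q \<eta> =
     (\<integral>\<^sup>+ t. ennreal (indicator {\<eta>..} t * (t powr (- real d / q) * \<phi> t)) \<partial>lebesgue_on {0..1})"

lemma truncated_theta_le:
  assumes "\<And>t. t \<in> {0..1} \<Longrightarrow> 0 \<le> \<phi> t"
  shows "truncated_theta d \<phi> q \<eta> \<le> theta d \<phi> q"
  unfolding truncated_theta_def theta_def
  by (intro nn_integral_mono) (use assms in \<open>auto simp: indicator_def\<close>)

lemma lebesgue_on_powr_weight_measurable:
  assumes "\<phi> \<in> borel_measurable (lebesgue_on {0..1})"
  shows "(\<lambda>t. indicator {\<eta>..} t * (t powr c * \<phi> t)) \<in> borel_measurable (lebesgue_on {0..1::real})"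
proof -
  have "(\<lambda>t::real. indicator {\<eta>..} t * t powr c) \<in> borel_measurable lborel" by measurable
  then have "(\<lambda>t::real. indicator {\<eta>..} t * t powr c) \<in> borel_measurable (lebesgue_on {0..1})"
    by (intro measurable_restrict_space1 measurable_completion)
  from borel_measurable_times[OF this assms] show ?thesis by (simp add: mult.assoc)
qed

lemma truncated_theta_tendsto:
  assumes "\<phi> \<in> borel_measurable (lebesgue_on {0..1})" "\<And>t. t \<in> {0..1} \<Longrightarrow> 0 \<le> \<phi> t"
  shows "(\<lambda>m. truncated_theta d \<phi> q (1 / real (m + 2))) \<longlonglongrightarrow> theta d \<phi> q"
proof -
  \<comment> \<open>For negative \<open>t\<close>, outside the domain of integration, the power need not vanish; hence the indicator in \<open>?g\<close>.\<close>
  let ?f = "\<lambda>m t. ennreal (indicator {1 / real (m + 2)..} t * (t powr (- real d / q) * \<phi> t))"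
  let ?g = "\<lambda>t. ennreal (indicator {0<..} t * (t powr (- real d / q) * \<phi> t))"
  have "(\<lambda>m. \<integral>\<^sup>+t. ?f m t \<partial>lebesgue_on {0..1}) \<longlonglongrightarrow> (\<integral>\<^sup>+t. ?g t \<partial>lebesgue_on {0..1})"
  proof (rule nn_integral_LIMSEQ)
    show "?f m \<in> borel_measurable (lebesgue_on {0..1})" for m
      using lebesgue_on_powr_weight_measurable[OF assms(1)] by measurable
    show "(\<lambda>m. ?f m t) \<longlonglongrightarrow> ?g t" for t
    proof (cases "t \<le> 0")
      case True
      then have "\<not> 1 / real (m + 2) \<le> t" for m
        by (smt (verit) divide_pos_pos of_nat_0_less_iff zero_less_numeral add_gr_0)
      with True show ?thesis by (simp add: indicator_def)
    next
      case False
      then have "\<forall>\<^sub>F m in sequentially. 1 / real (m + 2) < t"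
        using order_tendstoD(2)[OF LIMSEQ_ignore_initial_segment[OF lim_1_over_n, of 2], of t] by simp
      then have "\<forall>\<^sub>F m in sequentially. ?f m t = ?g t"
        by eventually_elim (use False in \<open>simp add: indicator_def\<close>)
      then show ?thesis by (rule tendsto_eventually)
    qed
    show "incseq ?f"
    proof (intro incseq_SucI le_funI)
      fix m t
      have "1 / real (Suc m + 2) \<le> 1 / real (m + 2)" by (intro divide_left_mono) auto
      then have "indicator {1 / real (m + 2)..} t \<le> (indicator {1 / real (Suc m + 2)..} t :: real)"
        by (intro indicator_leI) (auto intro: order_trans)
      then have "indicator {1 / real (m + 2)..} t * (t powr (- real d / q) * \<phi> t)
          \<le> indicator {1 / real (Suc m + 2)..} t * (t powr (- real d / q) * \<phi> t)
        \<or> t powr (- real d / q) * \<phi> t \<le> 0"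
        by (auto intro: mult_right_mono)
      then show "?f m t \<le> ?f (Suc m) t"
        by (auto intro: ennreal_leI simp: ennreal_neg mult_nonneg_nonpos)
    qed
  qed
  moreover have "(\<integral>\<^sup>+t. ?g t \<partial>lebesgue_on {0..1}) = theta d \<phi> q"
    unfolding theta_def by (intro nn_integral_cong) (auto simp: indicator_def)
  ultimately show ?thesis unfolding truncated_theta_def by simp
qed

section \<open>Near-extremal functions\<close>

lemma ennreal_divide_le_1:
  fixes x y :: ennreal
  assumes "x \<le> y"
  shows "x / y \<le> 1"
proof (cases "y = 0 \<or> y = \<infinity>")
  case True
  then show ?thesis using assms by (auto simp: divide_ennreal_def)
next
  case False
  have "x / y \<le> y / y" using assms by (rule divide_right_mono_ennreal)
  also have "y / y = 1" using False by (intro ennreal_divide_self) (auto simp: less_top)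
  finally show ?thesis .
qed

lemma ennreal_le_divide:
  fixes x y :: ennreal
  assumes "y \<le> 1"
  shows "x \<le> x / y"
proof (cases "y = 0")
  case True
  then show ?thesis by (cases "x = 0") (auto simp: ennreal_divide_eq_top_iff[THEN iffD2])
next
  case False
  then obtain r where r: "y = ennreal r" "0 < r" "r \<le> 1"
    using assms by (cases y) (auto simp: top_unique)
  show ?thesis
  proof (cases x)
    case (real z)
    then have "z * r \<le> z" using r by (intro mult_left_le) auto
    then show ?thesis using real r by (simp add: divide_ennreal pos_le_divide_eq ennreal_leI)
  next
    case top
    then show ?thesis using r by (simp add: ennreal_divide_eq_top_iff[THEN iffD2])
  qed
qed

text \<open>
  If \<open>\<eta>\<^sup>n < \<bar>x\<bar> \<le> 1\<close>, then \<open>tx\<close> lies in the annulus \<open>\<eta>\<^bsup>n+1\<^esup> < \<bar>y\<bar> \<le> 1\<close> for all \<open>t \<in> [\<eta>, 1]\<close>,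
  and homogeneity gives \<open>U \<phi> f x \<ge> \<bar>x\<bar>\<^bsup>-d/q\<^esup> T\<close>, where \<open>T\<close> is the truncated \<open>theta\<close>. Only the
  innermost of the \<open>n + 1\<close> annuli is given up.
\<close>

lemma nn_integral_U_annulus_power_ge:
  fixes \<phi> :: "real \<Rightarrow> real"
  assumes \<phi>: "\<phi> \<in> borel_measurable (lebesgue_on {0..1})" "\<And>t. t \<in> {0..1} \<Longrightarrow> 0 \<le> \<phi> t"
    "\<not> (AE t in lebesgue_on {0..1}. \<phi> t = 0)"
    and q: "1 \<le> q" and \<theta>: "theta CARD('d) \<phi> q < \<infinity>" and \<eta>: "0 < \<eta>" "\<eta> < 1"
    and f_def: "f = (annulus_power q (\<eta> ^ Suc n) :: real ^ 'd \<Rightarrow> real)"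
  shows "ennreal (enn2real (truncated_theta CARD('d) \<phi> q \<eta>) powr q) * annulus_mass TYPE('d) (\<eta> ^ n)
    \<le> (\<integral>\<^sup>+x. ennreal (\<bar>U \<phi> f x\<bar> powr q) \<partial>lborel)"
proof -
  let ?\<alpha> = "- real CARD('d) / q"
  define T where "T = enn2real (truncated_theta CARD('d) \<phi> q \<eta>)"
  have T: "truncated_theta CARD('d) \<phi> q \<eta> = ennreal T" "0 \<le> T"
    using truncated_theta_le[of \<phi> "CARD('d)" q \<eta>] \<phi>(2) \<theta> unfolding T_def
    by (auto simp: less_top intro: le_less_trans)
  have "annulus_mass TYPE('d) (\<eta> ^ Suc n) < \<infinity>"
    using \<eta> by (intro annulus_mass_finite) auto
  then have fin: "Lp_norm q f < \<infinity>"
    using q by (simp add: Lp_norm_lborel Let_def f_def nn_integral_annulus_power)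
  have [measurable]: "f \<in> borel_measurable borel" by (simp add: f_def)
  have int: "AE x in lborel. integrable (lebesgue_on {0..1}) (\<lambda>t. f (t *\<^sub>R x) * \<phi> t)"
    using U_Lp_bound(1)[OF \<phi> q \<theta> _ fin] by (simp add: AE_completion_iff measurable_completion)
  have "ennreal (T powr q) * annulus_mass TYPE('d) (\<eta> ^ n) = (\<integral>\<^sup>+x. ennreal (T powr q) *
     ennreal (indicator {\<eta> ^ n<..1} (norm (x :: real ^ 'd)) * norm x powr (- real CARD('d))) \<partial>lborel)"
    unfolding annulus_mass_def by (simp add: nn_integral_cmult)
  also have "\<dots> \<le> (\<integral>\<^sup>+x. ennreal (\<bar>U \<phi> f x\<bar> powr q) \<partial>lborel)"
  proof (rule nn_integral_mono_AE, use int in eventually_elim)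
    case (elim x)
    show ?case
    proof (cases "norm x \<in> {\<eta> ^ n<..1}")
      case False
      then have "indicator {\<eta> ^ n<..1} (norm x) = (0 :: real)" by (rule indicator_simps(2))
      then show ?thesis by simp
    next
      case True
      then have x: "\<eta> ^ n < norm x" "norm x \<le> 1" "0 < norm x"
        using \<eta> by (auto intro: less_trans[of 0 "\<eta> ^ n"] zero_less_power)
      have "ennreal (norm x powr ?\<alpha> * T) = ennreal (norm x powr ?\<alpha>) * truncated_theta CARD('d) \<phi> q \<eta>"
        using T by (simp add: ennreal_mult)
      also have "\<dots> = (\<integral>\<^sup>+t. ennreal (norm x powr ?\<alpha>) *
          ennreal (indicator {\<eta>..} t * (t powr ?\<alpha> * \<phi> t)) \<partial>lebesgue_on {0..1})"
        unfolding truncated_theta_def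
        by (intro nn_integral_cmult[symmetric] measurable_compose[OF _ measurable_ennreal]
            lebesgue_on_powr_weight_measurable \<phi>(1))
      also have "\<dots> \<le> (\<integral>\<^sup>+t. ennreal (f (t *\<^sub>R x) * \<phi> t) \<partial>lebesgue_on {0..1})"
      proof (rule nn_integral_mono)
        fix t :: real assume "t \<in> space (lebesgue_on {0..1})"
        then have t: "0 \<le> t" "t \<le> 1" by auto
        show "ennreal (norm x powr ?\<alpha>) * ennreal (indicator {\<eta>..} t * (t powr ?\<alpha> * \<phi> t))
            \<le> ennreal (f (t *\<^sub>R x) * \<phi> t)"
        proof (cases "\<eta> \<le> t")
          case True
          have "\<eta> ^ Suc n < t * norm x"
            using mult_le_less_imp_less[of \<eta> t "\<eta> ^ n" "norm x"] True x \<eta> by simp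
          moreover have "t * norm x \<le> 1" using t x by (simp add: mult_le_one)
          ultimately have "f (t *\<^sub>R x) = (t * norm x) powr ?\<alpha>"
            using t unfolding f_def annulus_power_def by (simp add: indicator_def)
          then show ?thesis
            using True t x \<phi>(2)[of t]
            by (simp add: ennreal_mult'[symmetric] powr_mult mult_ac)
        qed (simp add: indicator_def)
      qed
      also have "\<dots> = ennreal (U \<phi> f x)"
        unfolding U_def using elim \<phi>(2)
        by (intro nn_integral_eq_integral) (auto intro!: AE_I2 simp: f_def annulus_power_def)
      finally have "ennreal (norm x powr ?\<alpha> * T) \<le> ennreal \<bar>U \<phi> f x\<bar>"
        by (rule order_trans) (simp add: ennreal_leI)
      then have "(norm x powr ?\<alpha> * T) powr q \<le> \<bar>U \<phi> f x\<bar> powr q"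
        using q T by (intro powr_mono2) auto
      moreover have "(norm x powr ?\<alpha> * T) powr q = T powr q * norm x powr (- real CARD('d))"
        using q T by (simp add: powr_mult powr_powr)
      ultimately show ?thesis
        using True by (simp add: ennreal_mult'[symmetric] ennreal_leI)
    qed
  qed
  finally show ?thesis unfolding T_def .
qed

lemma PsiI_closed_interval:
  assumes "a < b" "continuous_on {a..b} \<psi>" "\<And>p. p \<in> {a..b} \<Longrightarrow> 0 < \<psi> p"
  shows "\<psi> \<in> Psi a (ereal b)"
proof -
  have S: "open_ivl a (ereal b) = {a<..<b}" by (auto simp: open_ivl_def)
  obtain m where m: "m \<in> {a..b}" "\<And>p. p \<in> {a..b} \<Longrightarrow> \<psi> m \<le> \<psi> p"
    using continuous_attains_inf[of "{a..b}" \<psi>] assms by auto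
  have "\<psi> m \<le> (INF p\<in>{a<..<b}. \<psi> p)"
    using assms(1) m by (intro cINF_greatest) auto
  then show ?thesis
    using assms m(1) unfolding Psi_def S by (force intro: continuous_on_subset)
qed

text \<open>
  A function with values in \<open>{0} \<union> [1, M]\<close> whose \<open>q\<close>-th power has integral \<open>m\<close> has \<open>L\<^sup>p\<close> norm at
  most this weight at \<open>p\<close>, for all exponents \<open>p\<close> at once, with equality at \<open>p = q\<close>. As a weight
  \<open>\<psi>\<close> it thus bounds the Grand Lebesgue norm of the function by \<open>1\<close>, and is manifestly continuous.
\<close>

definition annulus_weight :: "real \<Rightarrow> real \<Rightarrow> real \<Rightarrow> real \<Rightarrow> real" where
  "annulus_weight m M q p = (m * max 1 (M powr (p - q))) powr (1 / p)"

lemma annulus_weight_Psi: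
  assumes "0 < a" "a < b" "0 < m" "0 < M"
  shows "annulus_weight m M q \<in> Psi a (ereal b)"
proof (rule PsiI_closed_interval)
  show "continuous_on {a..b} (annulus_weight m M q)"
    unfolding annulus_weight_def using assms by (auto intro!: continuous_intros)
qed (use assms in \<open>auto simp: annulus_weight_def max_def\<close>)

lemma Lp_norm_annulus_power_le:
  assumes q: "1 \<le> q" and p: "1 \<le> p" and r: "0 < r" "r < 1"
    and m: "annulus_mass TYPE('d) r = ennreal m" "0 < m"
  shows "Lp_norm p (annulus_power q r :: real ^ 'd \<Rightarrow> real)
    \<le> ennreal (annulus_weight m (r powr (- real CARD('d) / q)) q p)"
proof -
  let ?f = "annulus_power q r :: real ^ 'd \<Rightarrow> real"
  define M where "M = r powr (- real CARD('d) / q)"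
  define C where "C = max 1 (M powr (p - q))"
  have "(\<integral>\<^sup>+x. ennreal (\<bar>?f x\<bar> powr p) \<partial>lborel)
      \<le> (\<integral>\<^sup>+x. ennreal C * ennreal (\<bar>?f x\<bar> powr q) \<partial>lborel)"
  proof (rule nn_integral_mono)
    fix x :: "real ^ 'd"
    have "\<bar>?f x\<bar> powr p \<le> C * \<bar>?f x\<bar> powr q"
    proof (cases "norm x \<in> {r<..1}")
      case True
      then have f: "?f x = norm x powr (- real CARD('d) / q)" by (simp add: annulus_power_def)
      have "1 powr (- real CARD('d) / q) \<le> norm x powr (- real CARD('d) / q)"
        using True r q by (intro powr_mono2') auto
      then have f1: "1 \<le> ?f x" using f by simp
      have fM: "?f x \<le> M"
        unfolding f M_def using True r q by (intro powr_mono2') auto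
      have "?f x powr (p - q) \<le> C"
      proof (cases "q \<le> p")
        case True
        then show ?thesis using f1 fM by (auto simp: C_def intro!: max.coboundedI2 powr_mono2)
      next
        case False
        then have "?f x powr (p - q) \<le> ?f x powr 0" using f1 by (intro powr_mono) auto
        then show ?thesis using f1 by (simp add: C_def)
      qed
      then have "?f x powr (p - q) * ?f x powr q \<le> C * ?f x powr q"
        by (intro mult_right_mono) auto
      then show ?thesis using f1 by (simp add: powr_add[symmetric])
    qed (use p in \<open>simp add: annulus_power_def\<close>)
    then show "ennreal (\<bar>?f x\<bar> powr p) \<le> ennreal C * ennreal (\<bar>?f x\<bar> powr q)"
      by (simp add: ennreal_mult'[symmetric] ennreal_leI C_def)
  qed
  also have "\<dots> = ennreal (C * m)"
    using m q by (simp add: nn_integral_cmult nn_integral_annulus_power C_def ennreal_mult)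
  also have "C * m = annulus_weight m M q p powr p"
    using p m by (simp add: annulus_weight_def C_def powr_powr mult.commute max_def)
  finally show ?thesis
    unfolding M_def using p by (subst Lp_norm_le_iff) (auto simp: annulus_weight_def)
qed

text \<open>
  The weight is matched to the test function, so that the denominator of the ratio is at most
  \<open>1\<close> and the numerator can be estimated at the single exponent \<open>q\<close>, the midpoint of the
  interval \<open>(p0, p0 + 2)\<close>, on which \<open>theta\<close> is finite. There the test function has mass
  \<open>n + 1\<close> and its image has mass at least \<open>T\<^sup>q n\<close>, in units of the mass of one annulus; this explains the
  two factors of the bound.
\<close>

lemma GL_norm_annulus_power_ratio:
  fixes \<phi> :: "real \<Rightarrow> real"
  assumes \<phi>: "\<phi> \<in> borel_measurable (lebesgue_on {0..1})" "\<And>t. t \<in> {0..1} \<Longrightarrow> 0 \<le> \<phi> t"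
    "\<not> (AE t in lebesgue_on {0..1}. \<phi> t = 0)"
    and p0: "1 \<le> p0" and \<theta>: "theta CARD('d) \<phi> p0 < \<infinity>" and \<eta>: "0 < \<eta>" "\<eta> < 1"
  defines "q \<equiv> p0 + 1" and "b \<equiv> ereal (p0 + 2)"
  obtains \<psi> and f :: "real ^ 'd \<Rightarrow> real" where
    "admissible CARD('d) \<phi> p0 b \<psi>" "f \<in> GL_space (open_ivl p0 b) \<psi>"
    "\<not> (AE x in lebesgue. f x = 0)"
    "ennreal (enn2real (truncated_theta CARD('d) \<phi> q \<eta>) / enn2real (theta CARD('d) \<phi> q)
        * (real n / real (Suc n)) powr (1 / q))
      \<le> GL_norm (AB CARD('d) \<phi> p0 b) (psi_theta CARD('d) \<phi> \<psi>) (U \<phi> f)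
          / GL_norm (open_ivl p0 b) \<psi> f"
proof -
  have S: "open_ivl p0 b = {p0<..<p0 + 2}" by (auto simp: open_ivl_def b_def)
  have fin: "theta CARD('d) \<phi> p < \<infinity>" if "p0 \<le> p" for p
    using theta_antimono[of \<phi> p0 p "CARD('d)"] \<phi>(2) p0 that \<theta> by (auto intro: le_less_trans)
  have sub: "open_ivl p0 b \<inter> supp_theta CARD('d) \<phi> = {p0<..<p0 + 2}"
    using fin p0 by (auto simp: S supp_theta_def)
  have AB: "AB CARD('d) \<phi> p0 b = {p0<..<p0 + 2}"
    by (simp add: AB_def sub)
  have q: "1 \<le> q" "q \<in> {p0<..<p0 + 2}" using p0 by (auto simp: q_def)
  define \<delta> where "\<delta> = \<eta> ^ Suc n"
  have \<delta>: "0 < \<delta>" "\<delta> < 1" using \<eta> by (auto simp: \<delta>_def power_Suc_less_one simp del: power_Suc)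
  obtain v where v: "annulus_mass TYPE('d) \<eta> = ennreal v" "0 < v"
    using annulus_mass_finite[where 'd = 'd, of \<eta>] annulus_mass_pos[where 'd = 'd, of \<eta>] \<eta>
    by (cases "annulus_mass TYPE('d) \<eta>") auto
  have mass: "annulus_mass TYPE('d) (\<eta> ^ k) = ennreal (real k * v)" for k
    using annulus_mass_power[OF \<eta>, where 'd = 'd, of k] v
    by (simp add: ennreal_mult ennreal_of_nat_eq_real_of_nat)
  define m where "m = real (Suc n) * v"
  have m: "annulus_mass TYPE('d) \<delta> = ennreal m" "0 < m"
    using mass[of "Suc n"] v unfolding \<delta>_def m_def by (auto simp del: power_Suc of_nat_Suc)
  define \<psi> where "\<psi> = annulus_weight m (\<delta> powr (- real CARD('d) / q)) q"
  define f :: "real ^ 'd \<Rightarrow> real" where "f = annulus_power q \<delta>"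
  have [measurable]: "f \<in> borel_measurable borel" by (simp add: f_def)
  have "\<psi> \<in> Psi p0 b"
    unfolding \<psi>_def b_def using p0 m \<delta> by (intro annulus_weight_Psi) auto
  then have adm: "admissible CARD('d) \<phi> p0 b \<psi>"
    unfolding admissible_def sub using p0 by (simp add: b_def is_interval_oo)
  have \<psi>_pos: "0 < \<psi> p" for p
    using m \<delta> by (auto simp: \<psi>_def annulus_weight_def max_def)
  have GL_f: "GL_norm (open_ivl p0 b) \<psi> f \<le> 1"
    unfolding GL_norm_def
  proof (rule SUP_least)
    fix p assume "p \<in> open_ivl p0 b"
    then have "1 \<le> p" using p0 by (auto simp: S)
    then have "Lp_norm p f \<le> ennreal (\<psi> p)"
      unfolding f_def \<psi>_def using q \<delta> m by (intro Lp_norm_annulus_power_le)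
    then have "Lp_norm p f / ennreal (\<psi> p) \<le> ennreal (\<psi> p) / ennreal (\<psi> p)"
      by (rule divide_right_mono_ennreal)
    then show "Lp_norm p f / ennreal (\<psi> p) \<le> 1"
      using \<psi>_pos[of p] by (simp add: divide_ennreal)
  qed
  have f_GL: "f \<in> GL_space (open_ivl p0 b) \<psi>"
    using GL_f by (auto simp: GL_space_def measurable_completion intro: le_less_trans)
  have nz: "\<not> (AE x in lebesgue. f x = 0)"
  proof
    assume "AE x in lebesgue. f x = 0"
    then have "AE x in lborel. f x = 0" by (simp add: AE_completion_iff)
    then have "AE x in lborel. ennreal (\<bar>f x\<bar> powr q) = 0" by eventually_elim (use q in simp)
    then have "(\<integral>\<^sup>+x. ennreal (\<bar>f x\<bar> powr q) \<partial>lborel) = 0"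
      by (subst nn_integral_0_iff_AE) auto
    then show False using m q by (simp add: f_def nn_integral_annulus_power)
  qed
  define T where "T = enn2real (truncated_theta CARD('d) \<phi> q \<eta>)"
  obtain W where W: "theta CARD('d) \<phi> q = ennreal W" "0 < W"
    using fin[of q] theta_pos[OF \<phi>, of "CARD('d)" q] q by (cases "theta CARD('d) \<phi> q") auto
  let ?c = "(real n / real (Suc n)) powr (1 / q)"
  have "\<psi> q powr q = m"
    using q m \<delta> by (simp add: \<psi>_def annulus_weight_def powr_powr)
  then have "ennreal ((T * ?c * \<psi> q) powr q) = ennreal (T powr q) * annulus_mass TYPE('d) (\<eta> ^ n)"
    using q \<psi>_pos[of q] v
    by (simp add: powr_mult powr_powr mass ennreal_mult'[symmetric] T_def m_def)
  also have "\<dots> \<le> (\<integral>\<^sup>+x. ennreal (\<bar>U \<phi> f x\<bar> powr q) \<partial>lborel)"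
    unfolding T_def using q fin[of q]
    by (intro nn_integral_U_annulus_power_ge[OF \<phi> _ _ \<eta>, where n = n]) (auto simp: f_def \<delta>_def)
  finally have "ennreal (T * ?c * \<psi> q) \<le> Lp_norm q (U \<phi> f)"
    using q \<psi>_pos[of q] by (subst ennreal_le_Lp_norm_iff) (auto simp: T_def)
  then have "ennreal (T * ?c * \<psi> q) / ennreal (\<psi> q * W)
      \<le> Lp_norm q (U \<phi> f) / ennreal (psi_theta CARD('d) \<phi> \<psi> q)"
    using W by (simp add: psi_theta_def divide_right_mono_ennreal)
  also have "\<dots> \<le> GL_norm (AB CARD('d) \<phi> p0 b) (psi_theta CARD('d) \<phi> \<psi>) (U \<phi> f)"
    unfolding GL_norm_def AB using q by (intro SUP_upper) auto
  also have "\<dots> \<le> GL_norm (AB CARD('d) \<phi> p0 b) (psi_theta CARD('d) \<phi> \<psi>) (U \<phi> f)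
      / GL_norm (open_ivl p0 b) \<psi> f"
    using GL_f by (rule ennreal_le_divide)
  also have "ennreal (T * ?c * \<psi> q) / ennreal (\<psi> q * W) = ennreal (T / W * ?c)"
    using \<psi>_pos[of q] W by (simp add: divide_ennreal T_def mult_ac)
  finally show thesis
    using that[OF adm f_GL nz] W unfolding T_def by simp
qed

theorem theorem3p1:
  fixes \<phi> :: "real \<Rightarrow> real"
  assumes "\<phi> \<in> borel_measurable (lebesgue_on {0..1})"
    and "\<And>t. t \<in> {0..1} \<Longrightarrow> 0 \<le> \<phi> t"
    and "\<not> (AE t in lebesgue_on {0..1}. \<phi> t = 0)"
  shows "(\<forall>a b \<psi>. admissible CARD('d) \<phi> a b \<psi> \<longrightarrow>
            (\<forall>f :: real ^ 'd \<Rightarrow> real. f \<in> GL_space (open_ivl a b) \<psi> \<longrightarrow>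
               (AE x in lebesgue. integrable (lebesgue_on {0..1}) (\<lambda>t. f (t *\<^sub>R x) * \<phi> t)) \<and>
               U \<phi> f \<in> borel_measurable lebesgue \<and>
               GL_norm (AB CARD('d) \<phi> a b) (psi_theta CARD('d) \<phi> \<psi>) (U \<phi> f)
                 \<le> 1 * GL_norm (open_ivl a b) \<psi> f)) \<and>
         ((\<exists>p\<ge>1. theta CARD('d) \<phi> p < \<infinity>) \<longrightarrow>
            (SUP (a, b, \<psi>) \<in> {(a, b, \<psi>). admissible CARD('d) \<phi> a b \<psi>}.
               SUP f \<in> {f :: real ^ 'd \<Rightarrow> real. f \<in> GL_space (open_ivl a b) \<psi> \<and>
                                           \<not> (AE x in lebesgue. f x = 0)}.
                 GL_norm (AB CARD('d) \<phi> a b) (psi_theta CARD('d) \<phi> \<psi>) (U \<phi> f)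
                   / GL_norm (open_ivl a b) \<psi> f) = 1)"
    (is "?bound \<and> (_ \<longrightarrow> ?S = 1)")
proof (intro conjI impI)
  show ?bound
    unfolding mult_1 using GL_norm_U_le[where 'd = 'd, OF assms] by blast
  have "?S \<le> 1"
    using GL_norm_U_le(3)[where 'd = 'd, OF assms] by (auto intro!: SUP_least ennreal_divide_le_1)
  assume "\<exists>p\<ge>1. theta CARD('d) \<phi> p < \<infinity>"
  then obtain p0 where p0: "1 \<le> p0" "theta CARD('d) \<phi> p0 < \<infinity>" by auto
  define q where "q = p0 + 1"
  define T where "T \<eta> = enn2real (truncated_theta CARD('d) \<phi> q \<eta>)" for \<eta>
  have fin: "theta CARD('d) \<phi> q < \<infinity>"
    using theta_antimono[of \<phi> p0 q "CARD('d)"] assms(2) p0 by (auto simp: q_def intro: le_less_trans)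
  obtain W where W: "theta CARD('d) \<phi> q = ennreal W" "0 < W"
    using fin theta_pos[OF assms, of "CARD('d)" q] by (cases "theta CARD('d) \<phi> q") auto
  have ratio: "ennreal (T \<eta> / W * (real n / real (Suc n)) powr (1 / q)) \<le> ?S"
    if \<eta>: "0 < \<eta>" "\<eta> < 1" for \<eta> n
  proof (rule GL_norm_annulus_power_ratio[where 'd = 'd, OF assms p0 \<eta>, of n])
    fix \<psi> and f :: "real ^ 'd \<Rightarrow> real"
    assume *: "admissible CARD('d) \<phi> p0 (ereal (p0 + 2)) \<psi>" "f \<in> GL_space (open_ivl p0 (ereal (p0 + 2))) \<psi>"
      "\<not> (AE x in lebesgue. f x = 0)"
      and le: "ennreal (enn2real (truncated_theta CARD('d) \<phi> (p0 + 1) \<eta>) / enn2real (theta CARD('d) \<phi> (p0 + 1))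
        * (real n / real (Suc n)) powr (1 / (p0 + 1)))
      \<le> GL_norm (AB CARD('d) \<phi> p0 (ereal (p0 + 2))) (psi_theta CARD('d) \<phi> \<psi>) (U \<phi> f)
          / GL_norm (open_ivl p0 (ereal (p0 + 2))) \<psi> f"
    have "ennreal (T \<eta> / W * (real n / real (Suc n)) powr (1 / q))
      \<le> GL_norm (AB CARD('d) \<phi> p0 (ereal (p0 + 2))) (psi_theta CARD('d) \<phi> \<psi>) (U \<phi> f)
          / GL_norm (open_ivl p0 (ereal (p0 + 2))) \<psi> f"
      using le W by (simp add: T_def q_def)
    also have "\<dots> \<le> ?S"
      using * by (intro SUP_upper2[of "(p0, ereal (p0 + 2), \<psi>)"]) (auto intro: SUP_upper2)
    finally show ?thesis .
  qed
  \<comment> \<open>First the number of annuli tends to infinity, then the cut-off \<open>\<eta>\<close> tends to \<open>0\<close>.\<close>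
  have T_le: "ennreal (T \<eta> / W) \<le> ?S" if "0 < \<eta>" "\<eta> < 1" for \<eta>
  proof (rule LIMSEQ_le_const2)
    have "(\<lambda>n. T \<eta> / W * (real n / real (Suc n)) powr (1 / q)) \<longlonglongrightarrow> T \<eta> / W * 1 powr (1 / q)"
      by (intro tendsto_intros LIMSEQ_n_over_Suc_n) auto
    then show "(\<lambda>n. ennreal (T \<eta> / W * (real n / real (Suc n)) powr (1 / q))) \<longlonglongrightarrow> ennreal (T \<eta> / W)"
      by (intro tendsto_ennrealI) simp
  qed (use ratio that in blast)
  have "1 \<le> ?S"
  proof (rule LIMSEQ_le_const2)
    have "(\<lambda>m. truncated_theta CARD('d) \<phi> q (1 / real (m + 2))) \<longlonglongrightarrow> ennreal W"
      using truncated_theta_tendsto[OF assms(1,2), of "CARD('d)" q] W by simp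
    then have "(\<lambda>m. T (1 / real (m + 2))) \<longlonglongrightarrow> W"
      unfolding T_def using W by (intro tendsto_enn2real) auto
    then have "(\<lambda>m. T (1 / real (m + 2)) / W) \<longlonglongrightarrow> W / W"
      using W by (intro tendsto_divide tendsto_const) auto
    then show "(\<lambda>m. ennreal (T (1 / real (m + 2)) / W)) \<longlonglongrightarrow> 1"
      using W tendsto_ennrealI by fastforce
    show "\<exists>N. \<forall>m\<ge>N. ennreal (T (1 / real (m + 2)) / W) \<le> ?S"
      by (intro exI allI impI T_le) auto
  qed
  with \<open>?S \<le> 1\<close> show "?S = 1" by (rule antisym)
qed

end
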